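(* For any real $r>0$ and positive integers $d$ and $m$ with $m\geq 2r$, the Cohn-Elkies linear programming bound in $\mathbb{R}^d$ is greater than or equal to the discrete Cohn-Elkies linear programming bound in $\mathbb{Z}_m^d$ (with parameter $r$).
   Context: Fourier transform on $\mathbb{R}^d$: $\widehat f(y)=\int_{\mathbb{R}^d} f(x)e^{-2\pi i\langle x,y\rangle}\,dx$, where $\langle x,y\rangle=x_1y_1+\cdots+x_dy_d$. A function $f:\mathbb{R}^d\to\mathbb{R}$ is rapidly decreasing if $f(x)=O\left((1+|x|)^{-k}\right)$ for all positive integers $k$; it is radial if $f(x)$ depends only on $|x|$. For fixed $r>0$ and positive integer $d$, the Cohn-Elkies linear programming bound in $\mathbb{R}^d$ is the infimum of $\left(\frac r2\right)^d f(0)$ over all radial, smooth, rapidly decreasing functions $f:\mathbb{R}^d\to\mathbb{R}$ such that $f(0)>0$; $\widehat f(0)\geq 1$; $f(x)\leq 0$ for all $|x|\geq r$; and $\widehat f(y)\geq 0$ for all $y\in\mathbb{R}^d$. This value does not depend on $r$ (by rescaling $f$). $\mathbb{Z}_m$ denotes $\mathbb{Z}/m\mathbb{Z}$, with coset representatives $x$ satisfying $-m/2<x\leq m/2$. Using these representatives, $\mathbb{Z}_m^d$ is embedded in $\mathbb{Z}^d\subset\mathbb{R}^d$, and for $x,y\in\mathbb{Z}_m^d$, $|x|$ denotes the Euclidean norm of the representative of $x$ and $\langle x,y\rangle=x_1y_1+\cdots+x_dy_d$. The discrete Fourier transform of $f:\mathbb{Z}_m^d\to\mathbb{R}$ is $\widehat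 f(y)=m^{-d/2}\sum_{x\in\mathbb{Z}_m^d} f(x)e^{-\frac{2\pi i}{m}\langle x,y\rangle}$. For fixed $r>0$ and positive integers $m,d$, the discrete Cohn-Elkies linear programming bound in $\mathbb{Z}_m^d$ is the infimum of $\left(\frac r2\right)^d f(0)$ over all even functions $f:\mathbb{Z}_m^d\to\mathbb{R}$ such that $\widehat f(0)\geq m^{-d/2}$; $f(x)\leq 0$ for all $x\in\mathbb{Z}_m^d$ with $|x|\geq r$; and $\widehat f(y)\geq 0$ for all $y\in\mathbb{Z}_m^d$. *)

theory Defs
  imports "HOL-Analysis.Analysis" "HOL-Number_Theory.Cong" "HOL-Library.Complex_Order"
begin

primrec C_k :: "nat \<Rightarrow> (real ^ 'd::finite \<Rightarrow> real) \<Rightarrow> bool" where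
  "C_k 0 f \<longleftrightarrow> continuous_on UNIV f"
| "C_k (Suc k) f \<longleftrightarrow> f differentiable_on UNIV \<and>
     (\<forall>v. C_k k (\<lambda>x. frechet_derivative f (at x) v))"

definition smooth :: "(real ^ 'd::finite \<Rightarrow> real) \<Rightarrow> bool" where
  "smooth f \<longleftrightarrow> (\<forall>k. C_k k f)"

definition rapidly_decreasing :: "(real ^ 'd::finite \<Rightarrow> real) \<Rightarrow> bool" where
  "rapidly_decreasing f \<longleftrightarrow>
     (\<forall>k::nat. k \<ge> 1 \<longrightarrow> (\<exists>C. \<forall>x. \<bar>f x\<bar> \<le> C / (1 + norm x) ^ k))"

definition radial :: "(real ^ 'd::finite \<Rightarrow> real) \<Rightarrow> bool" where
  "radial f \<longleftrightarrow> (\<forall>x y. norm x = norm y \<longrightarrow> f x = f y)"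

definition fourier :: "(real ^ 'd::finite \<Rightarrow> real) \<Rightarrow> real ^ 'd \<Rightarrow> complex" where
  "fourier f y =
     (LINT x|lborel. complex_of_real (f x) * exp (- 2 * pi * \<i> * complex_of_real (x \<bullet> y)))"

text \<open>
  The order on \<^typ>\<open>complex\<close> is the one under which \<open>a \<le> z\<close>, for real \<open>a\<close>, says that \<open>z\<close> is
  real and at least \<open>a\<close>.
\<close>

definition cohn_elkies_feasible :: "real \<Rightarrow> (real ^ 'd::finite \<Rightarrow> real) \<Rightarrow> bool" where
  "cohn_elkies_feasible r f \<longleftrightarrow>
     radial f \<and> smooth f \<and> rapidly_decreasing f \<and>
     f 0 > 0 \<and>
     fourier f 0 \<ge> 1 \<and>
     (\<forall>x. norm x \<ge> r \<longrightarrow> f x \<le> 0) \<and>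
     (\<forall>y. fourier f y \<ge> 0)"

text \<open>
  The dimension is the cardinality of the index type \<open>'d\<close>. The infima are taken in
  \<^typ>\<open>ereal\<close>, so that they are meaningful without first establishing that the sets are
  nonempty and bounded below.
\<close>

definition cohn_elkies_bound :: "'d::finite itself \<Rightarrow> real \<Rightarrow> ereal" where
  "cohn_elkies_bound _ r =
     (INF f \<in> {f :: real ^ 'd \<Rightarrow> real. cohn_elkies_feasible r f}. ereal ((r / 2) ^ CARD('d) * f 0))"

definition coset_reps :: "nat \<Rightarrow> (int ^ 'd::finite) set" where
  "coset_reps m = {x. \<forall>i. - real m / 2 < real_of_int (x $ i) \<and> real_of_int (x $ i) \<le> real m / 2}"

definition real_vec :: "int ^ 'd::finite \<Rightarrow> real ^ 'd" where
  "real_vec x = (\<chi> i. real_of_int (x $ i))"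

text \<open>
  A function on \<open>(\<int>/m\<int>)\<^sup>d\<close> is represented by its pullback to \<open>\<int>\<^sup>d\<close>, that is, by a function
  on integer vectors that respects componentwise congruence modulo \<open>m\<close>.
\<close>

definition periodic_mod :: "nat \<Rightarrow> (int ^ 'd::finite \<Rightarrow> real) \<Rightarrow> bool" where
  "periodic_mod m f \<longleftrightarrow> (\<forall>x y. (\<forall>i. [x $ i = y $ i] (mod int m)) \<longrightarrow> f x = f y)"

definition discrete_fourier :: "nat \<Rightarrow> (int ^ 'd::finite \<Rightarrow> real) \<Rightarrow> int ^ 'd \<Rightarrow> complex" where
  "discrete_fourier m f y =
     complex_of_real (real m powr (- real CARD('d) / 2)) *
     (\<Sum>x \<in> coset_reps m. complex_of_real (f x) *
        exp (- (2 * pi * \<i> / of_nat m) * of_int (\<Sum>i\<in>UNIV. x $ i * y $ i)))"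

definition discrete_cohn_elkies_feasible ::
    "nat \<Rightarrow> real \<Rightarrow> (int ^ 'd::finite \<Rightarrow> real) \<Rightarrow> bool" where
  "discrete_cohn_elkies_feasible m r f \<longleftrightarrow>
     periodic_mod m f \<and>
     (\<forall>x. f (- x) = f x) \<and>
     discrete_fourier m f 0 \<ge> complex_of_real (real m powr (- real CARD('d) / 2)) \<and>
     (\<forall>x \<in> coset_reps m. norm (real_vec x) \<ge> r \<longrightarrow> f x \<le> 0) \<and>
     (\<forall>y \<in> coset_reps m. discrete_fourier m f y \<ge> 0)"

definition discrete_cohn_elkies_bound :: "'d::finite itself \<Rightarrow> nat \<Rightarrow> real \<Rightarrow> ereal" where
  "discrete_cohn_elkies_bound _ m r =
     (INF f \<in> {f :: int ^ 'd \<Rightarrow> real. discrete_cohn_elkies_feasible m r f}.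
        ereal ((r / 2) ^ CARD('d) * f 0))"

end

theory Submission
  imports Defs "HOL-Probability.Sinc_Integral"
begin

text \<open>
  Every feasible function \<open>f\<close> on \<open>\<real>\<^sup>d\<close> is turned into a feasible function on \<open>(\<int>/m\<int>)\<^sup>d\<close> with no larger value at
  the origin, namely its periodization \<open>g x = (\<Sum>n. f (x + m n))\<close> with \<open>n\<close> ranging over \<open>\<int>\<^sup>d\<close>.

  The sign conditions are geometric. The chosen representative of a coset of \<open>m \<int>\<^sup>d\<close> is a shortest
  vector in it, so if it has norm at least \<open>r\<close>, every term of \<open>g\<close> is nonpositive. The nonzero
  vectors of \<open>m \<int>\<^sup>d\<close> have length at least \<open>m\<close>, hence at least \<open>r\<close>, so \<open>g 0 \<le> f 0\<close>.

  For the transform conditions, the discrete transform of \<open>g\<close> at \<open>y\<close> is \<open>m powr (- d / 2)\<close> times the sum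
  of \<open>f z * exp (- 2 \<pi> \<i> \<langle>z, y / m\<rangle>)\<close> over \<open>z \<in> \<int>\<^sup>d\<close> (\<open>discrete_fourier_periodization\<close>). By Poisson summation that
  sum is the sum of the Fourier transform of \<open>f\<close> over \<open>y / m + \<int>\<^sup>d\<close>, all of whose terms are
  nonnegative. It is enough to know that it dominates the single term at \<open>y / m\<close>
  (\<open>fourier_le_poisson_sum\<close>), and this inequality has a direct proof. Integrate \<open>f x * exp (- 2 \<pi> \<i> \<langle>x, t\<rangle>)\<close>
  against the Fejer kernel of \<open>\<real>\<^sup>d/\<int>\<^sup>d\<close>. The kernel is a trigonometric polynomial with nonnegative
  coefficients and constant coefficient one, so the integral is at least the Fourier transform of \<open>f\<close> at
  \<open>t\<close> (\<open>fourier_le_fejer_integral\<close>). As the order grows, the kernel concentrates near the lattice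
  points with mass one at each, so the integral converges to the lattice sum
  (\<open>fejer_vec_vcell_tendsto\<close>, combined over all lattice points by dominated convergence).
\<close>

section \<open>The Fejer kernel on the line\<close>

definition fejer :: "nat \<Rightarrow> real \<Rightarrow> real" where
  "fejer N x = (cmod (\<Sum>j<N. cis (2 * pi * real j * x)))\<^sup>2 / real N"

text \<open>
  The floor makes the intervals half-open, so that they tile the line exactly and their products
  tile \<open>\<real>\<^sup>d\<close>. Centering them at the integers keeps each lattice point in the interior of its own
  cell, away from the peaks of the kernel in the other cells.
\<close>

definition cell :: "int \<Rightarrow> real set" where
  "cell n = {x. \<lfloor>x + 1 / 2\<rfloor> = n}"

lemma fejer_nonneg: "fejer N x \<ge> 0"
  by (simp add: fejer_def)

lemma fejer_measurable [measurable]: "fejer N \<in> borel_measurable borel"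
  unfolding fejer_def cis_conv_exp by measurable

lemma cell_borel [measurable]: "cell n \<in> sets borel"
  unfolding cell_def by measurable

lemma fejer_trig_poly:
  "complex_of_real (fejer N x) =
     (\<Sum>p\<in>{..<N} \<times> {..<N}. cis (2 * pi * (real (fst p) - real (snd p)) * x)) / of_nat N"
proof -
  have "complex_of_real ((cmod (\<Sum>j<N. cis (2 * pi * real j * x)))\<^sup>2)
      = (\<Sum>j<N. cis (2 * pi * real j * x)) * cnj (\<Sum>j<N. cis (2 * pi * real j * x))"
    by (rule complex_norm_square)
  also have "\<dots> = (\<Sum>j<N. \<Sum>l<N. cis (2 * pi * (real j - real l) * x))"
    by (simp add: sum_product cis_cnj cis_mult algebra_simps)
  also have "\<dots> = (\<Sum>p\<in>{..<N} \<times> {..<N}. cis (2 * pi * (real (fst p) - real (snd p)) * x))"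
    by (simp add: sum.cartesian_product case_prod_beta)
  finally show ?thesis
    by (simp add: fejer_def)
qed

lemma fejer_cos:
  "fejer N x = (\<Sum>p\<in>{..<N} \<times> {..<N}. cos (2 * pi * (real (fst p) - real (snd p)) * x)) / real N"
  using arg_cong[OF fejer_trig_poly[of N x], of Re] by (simp add: Re_divide_of_nat)

text \<open>
  The interval has length one, so in the expansion into cosines of integer frequency only the \<open>N\<close>
  constant terms survive; they are divided by \<open>N\<close>.
\<close>

lemma has_bochner_integral_fejer_cell:
  assumes "N > 0"
  shows "has_bochner_integral lborel (\<lambda>x. indicator (cell n) x * fejer N x) 1"
proof -
  define F where "F = (\<lambda>x. (\<Sum>p\<in>{..<N} \<times> {..<N}.
      if fst p = snd p then x
      else sin (2 * pi * (real (fst p) - real (snd p)) * x) /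
           (2 * pi * (real (fst p) - real (snd p)))) / real N)"
  have deriv: "(F has_real_derivative fejer N x) (at x)" for x
  proof -
    have "((\<lambda>x. if fst p = snd p then x
        else sin (2 * pi * (real (fst p) - real (snd p)) * x) /
             (2 * pi * (real (fst p) - real (snd p)))) has_real_derivative
           cos (2 * pi * (real (fst p) - real (snd p)) * x)) (at x)" for p :: "nat \<times> nat"
    proof (cases "fst p = snd p")
      case False
      then have "2 * pi * (real (fst p) - real (snd p)) \<noteq> 0" by simp
      then have "((\<lambda>x. sin (2 * pi * (real (fst p) - real (snd p)) * x) / (2 * pi * (real (fst p) - real (snd p))))
        has_real_derivative cos (2 * pi * (real (fst p) - real (snd p)) * x)) (at x)"
        by - (rule derivative_eq_intros refl | simp)+
      then show ?thesis using False by simp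
    qed simp
    then show ?thesis
      unfolding F_def fejer_cos by (intro DERIV_cdivide DERIV_sum)
  qed
  have cont: "isCont (fejer N) x" for x
    unfolding fejer_def cis_conv_exp using assms by (intro continuous_intros) auto
  have "F (n + 1/2) - F (n - 1/2) = (\<Sum>p\<in>{..<N} \<times> {..<N}. if fst p = snd p then 1 else 0) / real N"
  proof -
    have z: "sin (2 * pi * (real j - real l) * (n + 1/2)) = 0" 
            "sin (2 * pi * (real j - real l) * (n - 1/2)) = 0" for j l
    proof -
      have "2 * pi * (real j - real l) * (n + 1/2) = pi * of_int ((int j - int l) * (2 * n + 1))"
           "2 * pi * (real j - real l) * (n - 1/2) = pi * of_int ((int j - int l) * (2 * n - 1))"
        by (auto simp: algebra_simps)
      then show "sin (2 * pi * (real j - real l) * (n + 1/2)) = 0" 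
            "sin (2 * pi * (real j - real l) * (n - 1/2)) = 0"
        by (simp_all only: sin_npi_int)
    qed
    show ?thesis
      unfolding F_def diff_divide_distrib[symmetric] sum_subtractf[symmetric]
      by (intro arg_cong2[where f="(/)"] sum.cong refl) (simp only: z, simp)
  qed
  also have "\<dots> = 1"
  proof -
    have "(\<Sum>p\<in>{..<N} \<times> {..<N}. if fst p = snd p then 1 else (0::real)) =
       (\<Sum>j<N. \<Sum>l<N. if j = l then 1 else 0)"
      unfolding sum.cartesian_product by (rule sum.cong) auto
    also have "\<dots> = real N" by simp
    finally show ?thesis using assms by simp
  qed
  finally have F: "F (n + 1/2) - F (n - 1/2) = 1" .
  have "has_bochner_integral lborel (\<lambda>x. fejer N x * indicator {n - 1/2..n + 1/2} x) 1"
    using has_bochner_integral_FTC_Icc_real[of "n - 1/2" "n + 1/2" F "fejer N"] deriv cont F by simp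
  moreover have "AE x in lborel. fejer N x * indicator {n - 1/2..n + 1/2} x = indicator (cell n) x * fejer N x"
    using AE_lborel_singleton[of "n + 1/2"]
    by eventually_elim (auto simp: indicator_def cell_def floor_eq_iff)
  ultimately show ?thesis
    by (subst (asm) has_bochner_integral_cong_AE) auto
qed

text \<open>
  Away from the integers the geometric series gives
  \<open>fejer N x = (sin (\<pi> N x) / sin (\<pi> x))\<^sup>2 / N\<close>. The bound expresses concentration at the integers in a form that is uniform in \<open>x\<close>: weighted by a function vanishing
  only at the integers, the kernel tends to zero.
\<close>

lemma fejer_mult_sin_le:
  "fejer N x * (sin (pi * x))\<^sup>2 \<le> 1 / real N"
proof -
  define z where "z = cis (2 * pi * x)"
  have s: "(\<Sum>j<N. cis (2 * pi * real j * x)) = (\<Sum>j<N. z ^ j)"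
    unfolding z_def Complex.DeMoivre by (simp add: algebra_simps)
  have "norm (z - 1) = 2 * \<bar>sin (pi * x)\<bar>"
    using dist_exp_i_1[of "2 * pi * x"] by (simp add: z_def cis_conv_exp)
  then have "2 * \<bar>sin (pi * x)\<bar> * norm (\<Sum>j<N. z ^ j) = norm (z ^ N - 1)"
    by (metis norm_mult power_diff_1_eq)
  also have "\<dots> \<le> 2"
    using norm_triangle_ineq4[of "z ^ N" 1] by (simp add: z_def norm_power)
  finally have "\<bar>sin (pi * x)\<bar> * norm (\<Sum>j<N. z ^ j) \<le> 1" by simp
  then have "(\<bar>sin (pi * x)\<bar> * norm (\<Sum>j<N. z ^ j))\<^sup>2 \<le> 1"
    by (intro power_le_one) auto
  then show ?thesis
    unfolding fejer_def s by (simp add: power_mult_distrib divide_right_mono mult.commute)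
qed

section \<open>The product kernel on unit cubes\<close>

text \<open>
  Fubini's theorem for a product of nonnegative functions of the single coordinates. It reduces the
  mass of the product kernel on a unit cube, and the integral of a product majorant, to dimension one.
\<close>

lemma has_bochner_integral_prod_vec:
  fixes h :: "'d::finite \<Rightarrow> real \<Rightarrow> real"
  assumes "\<And>i. has_bochner_integral lborel (h i) (c i)" and nonneg: "\<And>i x. h i x \<ge> 0"
  shows "has_bochner_integral lborel (\<lambda>x :: real ^ 'd. \<Prod>i\<in>UNIV. h i (x $ i)) (\<Prod>i\<in>UNIV. c i)"
proof (rule has_bochner_integral_nn_integral)
  have m [measurable]: "h i \<in> borel_measurable borel" for i
    using assms(1)[of i] by (auto simp: has_bochner_integral_iff)
  have c: "c i \<ge> 0" for i
  proof -
    have "c i = integral\<^sup>L lborel (h i)"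
      using assms(1)[of i] by (simp add: has_bochner_integral_iff)
    then show ?thesis
      using nonneg by (simp add: Bochner_Integration.integral_nonneg)
  qed
  then show "0 \<le> (\<Prod>i\<in>UNIV. c i)" by (simp add: prod_nonneg)
  show "AE x in lborel. 0 \<le> (\<Prod>i\<in>UNIV. h i (x $ i))" for x
    using nonneg by (simp add: prod_nonneg)
  have nth [measurable]: "(\<lambda>x :: real ^ 'd. x $ i) \<in> borel_measurable borel" for i
    by (intro borel_measurable_continuous_onI continuous_intros)
  show "(\<lambda>x :: real ^ 'd. \<Prod>i\<in>UNIV. h i (x $ i)) \<in> borel_measurable lborel" by measurable
  have B: "(Basis :: (real ^ 'd) set) = (\<lambda>i. axis i 1) ` UNIV"
    by (auto simp: Basis_vec_def)
  have inj: "inj (\<lambda>i::'d. axis i (1::real))"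
    by (auto simp: inj_on_def axis_eq_axis)
  have "(\<integral>\<^sup>+x. (\<Prod>b\<in>Basis. ennreal (h (axis_index b) (x \<bullet> b))) \<partial>(lborel :: (real ^ 'd) measure)) =
        (\<Prod>b\<in>(Basis :: (real ^ 'd) set). (\<integral>\<^sup>+x. ennreal (h (axis_index b) x) \<partial>lborel))"
    by (rule nn_integral_lborel_prod) auto
  also have "\<dots> = (\<Prod>i\<in>UNIV. (\<integral>\<^sup>+x. ennreal (h i x) \<partial>lborel))"
    unfolding B by (subst prod.reindex[OF inj]) simp
  also have "\<dots> = (\<Prod>i\<in>UNIV. ennreal (c i))"
    using assms by (intro prod.cong refl) (simp add: has_bochner_integral_iff nn_integral_eq_integral)
  also have "\<dots> = ennreal (\<Prod>i\<in>UNIV. c i)"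
    using c by (simp add: prod_ennreal)
  finally show "(\<integral>\<^sup>+x. ennreal (\<Prod>i\<in>UNIV. h i (x $ i)) \<partial>(lborel :: (real ^ 'd) measure)) = ennreal (\<Prod>i\<in>UNIV. c i)"
    unfolding B by (subst (asm) prod.reindex[OF inj]) (simp add: prod_ennreal nonneg inner_axis)
qed

definition fejer_vec :: "nat \<Rightarrow> real ^ 'd::finite \<Rightarrow> real" where
  "fejer_vec N x = (\<Prod>i\<in>UNIV. fejer N (x $ i))"

definition vcell :: "int ^ 'd::finite \<Rightarrow> (real ^ 'd) set" where
  "vcell n = {x. \<forall>i. x $ i \<in> cell (n $ i)}"

lemma vec_nth_borel [measurable]: "(\<lambda>x :: real ^ 'd::finite. x $ i) \<in> borel_measurable borel"
  by (intro borel_measurable_continuous_onI continuous_intros)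

lemma fejer_vec_nonneg: "fejer_vec N x \<ge> 0"
  by (simp add: fejer_vec_def prod_nonneg fejer_nonneg)

lemma fejer_vec_measurable [measurable]:
  "(fejer_vec N :: real ^ 'd::finite \<Rightarrow> real) \<in> borel_measurable borel"
  unfolding fejer_vec_def by measurable

lemma vcell_borel [measurable]: "(vcell n :: (real ^ 'd::finite) set) \<in> sets borel"
proof -
  have "vcell n = (\<Inter>i. (\<lambda>x :: real ^ 'd. x $ i) -` cell (n $ i) \<inter> space borel)"
    by (auto simp: vcell_def)
  also have "\<dots> \<in> sets borel"
    by (intro sets.finite_INT) (auto simp del: Int_UNIV_right space_borel intro!: measurable_sets[OF vec_nth_borel])
  finally show ?thesis .
qed

lemma indicator_vcell: "indicator (vcell n) x = (\<Prod>i\<in>UNIV. indicator (cell (n $ i)) (x $ i) :: real)"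
  by (auto simp: vcell_def indicator_def)

lemma vcell_disjoint: "n \<noteq> n' \<Longrightarrow> vcell n \<inter> vcell n' = {}"
  by (auto simp: vcell_def cell_def vec_eq_iff)

lemma ex_vcell: "\<exists>n. x \<in> vcell n"
  by (rule exI[of _ "\<chi> i. \<lfloor>x $ i + 1 / 2\<rfloor>"]) (simp add: vcell_def cell_def)

lemma prod_cis: "(\<Prod>i\<in>A. cis (a i)) = cis (\<Sum>i\<in>A. a i)"
  by (induction A rule: infinite_finite_induct) (auto simp: cis_mult)

text \<open>
  The frequencies are differences of integer vectors and all coefficients are nonnegative; this is
  what makes the kernel interact well with a nonnegative Fourier transform.
\<close>

lemma fejer_vec_trig_poly:
  fixes x :: "real ^ 'd::finite"
  shows "complex_of_real (fejer_vec N x) =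
     (\<Sum>p\<in>PiE UNIV (\<lambda>_::'d. {..<N} \<times> {..<N}).
        cis (2 * pi * (x \<bullet> (\<chi> i. real (fst (p i)) - real (snd (p i)))))) / of_nat N ^ CARD('d)"
proof -
  have "complex_of_real (fejer_vec N x) = 
     (\<Prod>i\<in>UNIV. \<Sum>p\<in>{..<N} \<times> {..<N}. cis (2 * pi * (real (fst p) - real (snd p)) * x $ i)) / of_nat N ^ CARD('d)"
    by (simp add: fejer_vec_def fejer_trig_poly prod_dividef)
  also have "(\<Prod>i\<in>UNIV. \<Sum>p\<in>{..<N} \<times> {..<N}. cis (2 * pi * (real (fst p) - real (snd p)) * x $ i)) =
     (\<Sum>p\<in>PiE UNIV (\<lambda>_::'d. {..<N} \<times> {..<N}).
        \<Prod>i\<in>UNIV. cis (2 * pi * (real (fst (p i)) - real (snd (p i))) * x $ i))"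
    by (rule prod_sum_PiE) auto
  also have "\<dots> = (\<Sum>p\<in>PiE UNIV (\<lambda>_::'d. {..<N} \<times> {..<N}).
        cis (2 * pi * (x \<bullet> (\<chi> i. real (fst (p i)) - real (snd (p i))))))"
    by (simp add: prod_cis inner_vec_def sum_distrib_left mult_ac)
  finally show ?thesis .
qed

lemma has_bochner_integral_fejer_vec_vcell:
  assumes "N > 0"
  shows "has_bochner_integral lborel (\<lambda>x :: real ^ 'd::finite. indicator (vcell n) x * fejer_vec N x) 1"
  using has_bochner_integral_prod_vec[OF has_bochner_integral_fejer_cell[OF assms], where ?'d='d, of "\<lambda>i. n $ i"]
  by (simp add: indicator_vcell fejer_vec_def prod.distrib fejer_nonneg)

text \<open>
  Bounding the factor \<open>fejer N x\<^sub>i * sin\<^sup>2 (\<pi> x\<^sub>i)\<close> by \<open>1 / N\<close> leaves the kernel in the other directions,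
  which has mass one, and the indicator of a unit interval in direction \<open>i\<close>.
\<close>

lemma fejer_vec_vcell_sin:
  assumes "N > 0"
  shows "integrable lborel (\<lambda>x :: real ^ 'd::finite. indicator (vcell n) x * fejer_vec N x * (sin (pi * x $ i))\<^sup>2)"
    and "(LINT x|lborel. indicator (vcell n) x * fejer_vec N (x :: real ^ 'd::finite) * (sin (pi * x $ i))\<^sup>2) \<le> 1 / N"
proof -
  have int: "integrable lborel (\<lambda>x :: real ^ 'd. indicator (vcell n) x * fejer_vec N x)"
    using has_bochner_integral_fejer_vec_vcell[OF assms] by (auto simp: has_bochner_integral_iff)
  show i: "integrable lborel (\<lambda>x :: real ^ 'd. indicator (vcell n) x * fejer_vec N x * (sin (pi * x $ i))\<^sup>2)"
    by (rule Bochner_Integration.integrable_bound[OF int])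
      (auto simp: abs_mult abs_square_le_1 intro!: mult_left_le)
  define h where "h = (\<lambda>j x. indicator (cell (n $ j)) x * (if j = i then 1 else fejer N x))"
  have "has_bochner_integral lborel (h j) 1" for j
  proof (cases "j = i")
    case True
    have "h j = (\<lambda>x. indicator {real_of_int (n $ j) - 1/2..<n $ j + 1/2} x)"
      by (auto simp: h_def True fun_eq_iff indicator_def cell_def floor_eq_iff)
    then show ?thesis by (simp add: has_bochner_integral_iff)
  next
    case False
    then show ?thesis using has_bochner_integral_fejer_cell[OF assms] by (simp add: h_def)
  qed
  from has_bochner_integral_prod_vec[OF this]
  have h: "has_bochner_integral lborel (\<lambda>x :: real ^ 'd. \<Prod>j\<in>UNIV. h j (x $ j)) 1"
    by (simp add: h_def fejer_nonneg)
  have "indicator (vcell n) x * fejer_vec N x * (sin (pi * x $ i))\<^sup>2 \<le> (\<Prod>j\<in>UNIV. h j (x $ j)) * (1 / N)" for x :: "real ^ 'd"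
  proof -
    have u: "(UNIV :: 'd set) = insert i (UNIV - {i})" by auto
    let ?R = "\<Prod>j\<in>UNIV - {i}. indicator (cell (n $ j)) (x $ j) * fejer N (x $ j)"
    have "indicator (vcell n) x * fejer_vec N x = (\<Prod>j\<in>UNIV. indicator (cell (n $ j)) (x $ j) * fejer N (x $ j))"
      by (simp add: indicator_vcell fejer_vec_def prod.distrib)
    also have "\<dots> = indicator (cell (n $ i)) (x $ i) * fejer N (x $ i) * ?R"
      by (subst u, subst prod.insert) auto
    finally have 1: "indicator (vcell n) x * fejer_vec N x * (sin (pi * x $ i))\<^sup>2 = 
        (indicator (cell (n $ i)) (x $ i) * ?R) * (fejer N (x $ i) * (sin (pi * x $ i))\<^sup>2)" by simp
    have "(\<Prod>j\<in>UNIV. h j (x $ j)) = indicator (cell (n $ i)) (x $ i) * ?R"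
      by (subst u, subst prod.insert) (auto simp: h_def)
    then show ?thesis
      unfolding 1 by (simp only:) (intro mult_left_mono fejer_mult_sin_le mult_nonneg_nonneg prod_nonneg,
        auto simp: fejer_nonneg)
  qed
  then have "(LINT x|lborel. indicator (vcell n) x * fejer_vec N (x :: real ^ 'd) * (sin (pi * x $ i))\<^sup>2) \<le> 
     (LINT x|lborel. (\<Prod>j\<in>UNIV. h j ((x :: real ^ 'd) $ j)) * (1 / N))"
    using h by (intro integral_mono i) (auto simp: has_bochner_integral_iff)
  also have "\<dots> = 1 / N" using h by (simp add: has_bochner_integral_iff)
  finally show "(LINT x|lborel. indicator (vcell n) x * fejer_vec N (x :: real ^ 'd::finite) * (sin (pi * x $ i))\<^sup>2) \<le> 1 / N" .
qed

section \<open>Positivity of the Fourier transform against the Fejer kernel\<close>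

lemma fourier_cis: "fourier f y = (LINT x|lborel. complex_of_real (f x) * cis (- 2 * pi * (x \<bullet> y)))"
  unfolding fourier_def cis_conv_exp by (simp add: mult_ac)

text \<open>
  Expanding the kernel turns the integral into the average, over pairs \<open>(j, l)\<close> of vectors in
  \<open>{0..<N}\<^sup>d\<close> and with weight \<open>1 / N\<^sup>d\<close>, of the values of the Fourier transform at \<open>t - (j - l)\<close>. All are nonnegative, and
  the \<open>N\<^sup>d\<close> diagonal pairs alone contribute the value at \<open>t\<close>.
\<close>

lemma fourier_le_fejer_integral:
  fixes f :: "real ^ 'd::finite \<Rightarrow> real"
  assumes f: "integrable lborel f" and pos: "\<And>y. fourier f y \<ge> 0" and "N > 0"
  shows "fourier f t \<le> (LINT x|lborel. complex_of_real (f x) * cis (- 2 * pi * (x \<bullet> t)) * fejer_vec N x)"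
proof -
  let ?P = "PiE UNIV (\<lambda>_::'d. {..<N} \<times> {..<N})"
  \<comment> \<open>the diagonal pairs\<close>
  let ?D = "(\<lambda>q i. (q i, q i)) ` PiE UNIV (\<lambda>_::'d. {..<N})"
  define v where "v = (\<lambda>p :: 'd \<Rightarrow> nat \<times> nat. (\<chi> i. real (fst (p i)) - real (snd (p i))) :: real ^ 'd)"
  have [measurable]: "f \<in> borel_measurable borel" using f by auto
  have int: "integrable lborel (\<lambda>x. complex_of_real (f x) * cis (- 2 * pi * (x \<bullet> y)))" for y
    unfolding cis_conv_exp by (rule Bochner_Integration.integrable_bound[OF f]) (auto simp: norm_mult)
  have "(LINT x|lborel. complex_of_real (f x) * cis (- 2 * pi * (x \<bullet> t)) * fejer_vec N x)
      = (LINT x|lborel. (\<Sum>p\<in>?P. complex_of_real (f x) * cis (- 2 * pi * (x \<bullet> (t - v p)))) / of_nat N ^ CARD('d))"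
    by (intro Bochner_Integration.integral_cong refl)
      (simp add: fejer_vec_trig_poly v_def sum_distrib_left cis_mult inner_diff_right algebra_simps)
  also have "\<dots> = (\<Sum>p\<in>?P. fourier f (t - v p)) / of_nat N ^ CARD('d)"
    unfolding fourier_cis by (simp only: integral_divide_zero Bochner_Integration.integral_sum[OF int])
  finally have eq: "(LINT x|lborel. complex_of_real (f x) * cis (- 2 * pi * (x \<bullet> t)) * fejer_vec N x)
     = (\<Sum>p\<in>?P. fourier f (t - v p)) / of_nat N ^ CARD('d)" .
  have "(\<Sum>p\<in>?D. fourier f (t - v p)) \<le> (\<Sum>p\<in>?P. fourier f (t - v p))"
    by (intro sum_mono2 finite_PiE) (auto simp: pos PiE_iff)
  moreover have "(\<Sum>p\<in>?D. fourier f (t - v p)) = (\<Sum>p\<in>?D. fourier f t)"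
    by (intro sum.cong refl) (auto simp: v_def zero_vec_def[symmetric])
  moreover have "card ?D = N ^ CARD('d)"
    by (subst card_image) (auto simp: card_PiE inj_on_def fun_eq_iff)
  ultimately have "of_nat N ^ CARD('d) * fourier f t \<le> (\<Sum>p\<in>?P. fourier f (t - v p))"
    by simp
  moreover have "complex_of_nat N ^ CARD('d) = of_real (real N ^ CARD('d))" by simp
  ultimately show ?thesis
    using \<open>N > 0\<close> unfolding eq
    by (simp add: less_eq_complex_def Re_divide_of_real Im_divide_of_real field_simps del: of_real_power of_real_of_nat_eq)
qed

section \<open>Concentration at lattice points\<close>

text \<open>
  The function \<open>sin\<^sup>2 (\<pi> x)\<close> has period one and grows with \<open>\<bar>x\<bar>\<close> up to \<open>\<bar>x\<bar> = 1 / 2\<close>.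
\<close>

lemma sin_sqr_lower_bound:
  assumes "\<bar>x - real_of_int n\<bar> \<le> 1 / 2" "\<bar>x - real_of_int n\<bar> \<ge> \<eta>" "\<eta> \<ge> 0"
  shows "(sin (pi * \<eta>))\<^sup>2 \<le> (sin (pi * x))\<^sup>2"
proof -
  define u where "u = x - real_of_int n"
  have "(cos (pi * real_of_int n))\<^sup>2 = 1"
    by (simp add: cos_squared_eq)
  moreover have "sin (pi * x) = sin (pi * u) * cos (pi * real_of_int n)"
    using sin_add[of "pi * u" "pi * real_of_int n"] by (simp add: u_def algebra_simps)
  ultimately have "(sin (pi * x))\<^sup>2 = (sin (pi * u))\<^sup>2"
    by (simp add: power_mult_distrib)
  also have "\<dots> = (sin (pi * \<bar>u\<bar>))\<^sup>2"
    by (simp add: abs_if)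
  also have "\<dots> \<ge> (sin (pi * \<eta>))\<^sup>2"
  proof (rule power_mono)
    show "sin (pi * \<eta>) \<le> sin (pi * \<bar>u\<bar>)"
      using assms by (intro sin_monotone_2pi_le) (auto simp: u_def field_simps intro: order_trans[of _ 0])
    show "0 \<le> sin (pi * \<eta>)"
      using assms by (intro sin_ge_zero) auto
  qed
  finally show ?thesis .
qed

text \<open>
  The kernel restricted to a cell is a probability density that concentrates at the center \<open>n\<close>. Near
  \<open>n\<close> continuity controls \<open>g x - g n\<close>; elsewhere in the cell some \<open>sin\<^sup>2 (\<pi> x\<^sub>i)\<close> is bounded below, so a
  multiple of the sum of these squares dominates \<open>2 * B\<close>, and its integral against the kernel is \<open>O(1 / N)\<close>.
\<close>

lemma fejer_vec_vcell_tendsto: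
  fixes g :: "real ^ 'd::finite \<Rightarrow> complex"
  assumes cont: "continuous_on UNIV g" and bound: "\<And>x. norm (g x) \<le> B"
  shows "(\<lambda>N. LINT x|lborel. (indicator (vcell n) x * fejer_vec N x) *\<^sub>R g x) \<longlonglongrightarrow> g (real_vec n)"
proof (rule tendstoI)
  fix \<epsilon> :: real assume "\<epsilon> > 0"
  let ?d = "real CARD('d)"
  have "isCont g (real_vec n)"
    using cont by (simp add: continuous_on_eq_continuous_at)
  then obtain \<delta> where \<delta>: "\<delta> > 0" "\<And>x. dist x (real_vec n) < \<delta> \<Longrightarrow> dist (g x) (g (real_vec n)) < \<epsilon> / 2"
    using \<open>\<epsilon> > 0\<close> unfolding continuous_at_eps_delta by (metis half_gt_zero)
  \<comment> \<open>coordinatewise distance below \<open>\<eta>\<close> forces Euclidean distance below \<open>\<delta>\<close>, and \<open>\<eta> \<le> 1 / 2\<close> keeps \<open>sin\<close> monotone\<close>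
  define \<eta> where "\<eta> = min (1 / 2) (\<delta> / ?d)"
  have \<eta>: "\<eta> > 0" "\<eta> \<le> 1 / 2" "?d * \<eta> \<le> \<delta>"
    using \<delta>(1) by (auto simp: \<eta>_def min_def field_simps)
  define s where "s = (sin (pi * \<eta>))\<^sup>2"
  have "sin (pi * \<eta>) > 0" using \<eta> by (intro sin_gt_zero) auto
  then have s: "s > 0" by (simp add: s_def)
  have B: "B \<ge> 0" using bound[of 0] norm_ge_zero order_trans by blast
  have close: "norm (g x - g (real_vec n)) \<le> \<epsilon> / 2 + 2 * B / s * (\<Sum>i\<in>UNIV. (sin (pi * x $ i))\<^sup>2)"
    if x: "x \<in> vcell n" for x
  proof (cases "\<forall>i. \<bar>x $ i - n $ i\<bar> < \<eta>")
    case True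
    have "dist x (real_vec n) \<le> (\<Sum>i\<in>UNIV. \<bar>(x - real_vec n) $ i\<bar>)"
      unfolding dist_norm by (rule norm_le_l1_cart)
    also have "\<dots> < (\<Sum>i\<in>(UNIV :: 'd set). \<eta>)"
      using True by (intro sum_strict_mono) (auto simp: real_vec_def)
    also have "\<dots> \<le> \<delta>" using \<eta> by simp
    finally have "norm (g x - g (real_vec n)) \<le> \<epsilon> / 2"
      using \<delta>(2)[of x] by (simp add: dist_norm)
    moreover have "0 \<le> 2 * B / s * (\<Sum>i\<in>UNIV. (sin (pi * x $ i))\<^sup>2)"
      using B s by (intro mult_nonneg_nonneg sum_nonneg) auto
    ultimately show ?thesis by linarith
  next
    case False
    then obtain i where i: "\<bar>x $ i - n $ i\<bar> \<ge> \<eta>" by (auto simp: not_less)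
    have "real_of_int (n $ i) \<le> x $ i + 1 / 2" "x $ i + 1 / 2 < n $ i + 1"
      using x by (auto simp: vcell_def cell_def floor_eq_iff)
    then have "\<bar>x $ i - n $ i\<bar> \<le> 1 / 2" by linarith
    then have "s \<le> (sin (pi * x $ i))\<^sup>2"
      unfolding s_def using i \<eta> by (intro sin_sqr_lower_bound) auto
    also have "\<dots> \<le> (\<Sum>i\<in>UNIV. (sin (pi * x $ i))\<^sup>2)"
      by (intro member_le_sum) auto
    finally have "2 * B / s * s \<le> 2 * B / s * (\<Sum>i\<in>UNIV. (sin (pi * x $ i))\<^sup>2)"
      using B s by (intro mult_left_mono) auto
    moreover have "norm (g x - g (real_vec n)) \<le> 2 * B"
      using norm_triangle_ineq4[of "g x" "g (real_vec n)"] bound[of x] bound[of "real_vec n"] by linarith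
    ultimately show ?thesis using \<open>\<epsilon> > 0\<close> s by simp
  qed
  have gm [measurable]: "g \<in> borel_measurable borel"
    using cont by (rule borel_measurable_continuous_onI)
  have main: "dist (LINT x|lborel. (indicator (vcell n) x * fejer_vec N x) *\<^sub>R g x) (g (real_vec n))
        \<le> \<epsilon> / 2 + 2 * B / s * ?d * (1 / real N)" if "N > 0" for N
  proof -
    define W where "W = (\<lambda>x :: real ^ 'd. indicator (vcell n) x * fejer_vec N x)"
    have W: "has_bochner_integral lborel W 1"
      unfolding W_def by (rule has_bochner_integral_fejer_vec_vcell[OF \<open>N > 0\<close>])
    have Wint: "integrable lborel W" and Wone: "(LINT x|lborel. W x) = 1"
      using W by (auto simp: has_bochner_integral_iff)
    have [measurable]: "W \<in> borel_measurable borel" unfolding W_def by measurable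
    have W0: "W x \<ge> 0" for x by (simp add: W_def fejer_vec_nonneg)
    have int: "integrable lborel (\<lambda>x. W x *\<^sub>R g x)"
      by (rule Bochner_Integration.integrable_bound[of _ "\<lambda>x. W x * B"])
        (use Wint W0 bound B in \<open>auto simp: abs_mult intro!: mult_left_mono\<close>)
    have sinint: "integrable lborel (\<lambda>x. W x * (sin (pi * x $ i))\<^sup>2)"
      "(LINT x|lborel. W x * (sin (pi * x $ i))\<^sup>2) \<le> 1 / N" for i
      unfolding W_def using fejer_vec_vcell_sin[OF \<open>N > 0\<close>] by auto
    have "(LINT x|lborel. W x *\<^sub>R g x) - g (real_vec n) = (LINT x|lborel. W x *\<^sub>R (g x - g (real_vec n)))"
      using int Wint Wone by (simp add: scaleR_diff_right)
    also have "norm \<dots> \<le> (LINT x|lborel. norm (W x *\<^sub>R (g x - g (real_vec n))))"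
      by (rule integral_norm_bound)
    also have "\<dots> \<le> (LINT x|lborel. W x * (\<epsilon> / 2) + (\<Sum>i\<in>UNIV. 2 * B / s * (W x * (sin (pi * x $ i))\<^sup>2)))"
    proof (rule integral_mono)
      show "integrable lborel (\<lambda>x. norm (W x *\<^sub>R (g x - g (real_vec n))))"
        using int Wint by (intro integrable_norm) (simp add: scaleR_diff_right)
      show "integrable lborel (\<lambda>x. W x * (\<epsilon> / 2) + (\<Sum>i\<in>UNIV. 2 * B / s * (W x * (sin (pi * x $ i))\<^sup>2)))"
        using Wint sinint by (intro Bochner_Integration.integrable_add Bochner_Integration.integrable_sum) auto
      show "norm (W x *\<^sub>R (g x - g (real_vec n))) \<le> W x * (\<epsilon> / 2) + (\<Sum>i\<in>UNIV. 2 * B / s * (W x * (sin (pi * x $ i))\<^sup>2))" for x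
      proof (cases "x \<in> vcell n")
        case True
        show ?thesis
          using mult_left_mono[OF close[OF True] W0[of x]] W0[of x]
          by (simp add: distrib_left sum_distrib_left mult_ac)
      qed (simp add: W_def)
    qed
    also have "\<dots> = \<epsilon> / 2 + (\<Sum>i\<in>UNIV. 2 * B / s * (LINT x|lborel. W x * (sin (pi * x $ i))\<^sup>2))"
      using Wint sinint Wone by (simp add: Bochner_Integration.integral_add)
    also have "\<dots> \<le> \<epsilon> / 2 + (\<Sum>i\<in>(UNIV :: 'd set). 2 * B / s * (1 / real N))"
      using sinint B s by (intro add_left_mono sum_mono mult_left_mono) auto
    finally show ?thesis
      by (simp add: W_def dist_norm mult_ac)
  qed
  have "(\<lambda>N. \<epsilon> / 2 + 2 * B / s * ?d * (1 / real N)) \<longlonglongrightarrow> \<epsilon> / 2 + 2 * B / s * ?d * 0"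
    by (intro tendsto_intros lim_1_over_n)
  then have "\<forall>\<^sub>F N in sequentially. \<epsilon> / 2 + 2 * B / s * ?d * (1 / real N) < \<epsilon>"
    by (rule order_tendstoD(2)) (use \<open>\<epsilon> > 0\<close> in simp)
  then show "\<forall>\<^sub>F N in sequentially. dist (LINT x|lborel. (indicator (vcell n) x * fejer_vec N x) *\<^sub>R g x) (g (real_vec n)) < \<epsilon>"
    using eventually_gt_at_top[of 0]
  proof eventually_elim
    case (elim N)
    then show ?case using main[of N] by linarith
  qed
qed

section \<open>Decay and summability over the lattice\<close>

text \<open>
  A product majorant for rapidly decreasing functions: it is integrable by Fubini and comparable to a
  constant on each unit cell.
\<close>

definition decay :: "real ^ 'd::finite \<Rightarrow> real" where
  "decay x = (\<Prod>i\<in>UNIV. 1 / (1 + (x $ i)\<^sup>2))"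

lemma decay_measurable [measurable]: "(decay :: real ^ 'd::finite \<Rightarrow> real) \<in> borel_measurable borel"
  unfolding decay_def by measurable

lemma decay_pos: "decay x > 0"
  unfolding decay_def by (intro prod_pos) (simp add: add_pos_nonneg)

lemma decay_le_1: "decay x \<le> 1"
  unfolding decay_def by (intro prod_le_1) (auto simp: divide_le_eq_1 add_pos_nonneg)

lemma integrable_decay: "integrable lborel (decay :: real ^ 'd::finite \<Rightarrow> real)"
proof -
  have "integrable lborel (\<lambda>x::real. 1 / (1 + x\<^sup>2))"
    using integrable_inverse_1_plus_square by (simp add: set_integrable_def inverse_eq_divide)
  then have "has_bochner_integral lborel (\<lambda>x::real. 1 / (1 + x\<^sup>2)) (LINT x|lborel. 1 / (1 + x\<^sup>2))"
    by (rule has_bochner_integral_integrable)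
  from has_bochner_integral_prod_vec[OF this, where ?'d='d] show ?thesis
    unfolding decay_def by (auto simp: has_bochner_integral_iff)
qed

lemma decay_vcell:
  fixes x :: "real ^ 'd::finite"
  assumes "x \<in> vcell n"
  shows "decay x \<le> 2 ^ CARD('d) * decay (real_vec n)" "decay (real_vec n) \<le> 2 ^ CARD('d) * decay x"
proof -
  have *: "1 + a\<^sup>2 \<le> 2 * (1 + b\<^sup>2)" if "\<bar>a - b\<bar> \<le> 1 / 2" for a b :: real
  proof -
    have "(a - b)\<^sup>2 \<le> 1 / 4"
      using power_mono[OF that abs_ge_zero, of 2] by (simp add: power2_eq_square)
    moreover have "a\<^sup>2 \<le> 2 * b\<^sup>2 + 2 * (a - b)\<^sup>2"
      using zero_le_power2[of "a - 2 * b"] by (simp add: power2_eq_square algebra_simps)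
    ultimately show ?thesis by argo
  qed
  have d: "1 / (1 + a\<^sup>2) \<le> 2 * (1 / (1 + b\<^sup>2))" if "\<bar>a - b\<bar> \<le> 1 / 2" for a b :: real
    using *[of b a] that by (simp add: divide_simps abs_minus_commute add_pos_nonneg)
  have x: "\<bar>x $ i - real_vec n $ i\<bar> \<le> 1 / 2" for i
  proof -
    have "real_of_int (n $ i) \<le> x $ i + 1 / 2" "x $ i + 1 / 2 < n $ i + 1"
      using assms by (auto simp: vcell_def cell_def floor_eq_iff)
    then show ?thesis unfolding real_vec_def vec_lambda_beta by linarith
  qed
  have e: "2 ^ CARD('d) * decay y = (\<Prod>i\<in>UNIV. 2 * (1 / (1 + (y $ i)\<^sup>2)))" for y :: "real ^ 'd"
    unfolding decay_def by (simp add: prod_dividef)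
  show "decay x \<le> 2 ^ CARD('d) * decay (real_vec n)"
    unfolding e unfolding decay_def by (intro prod_mono conjI d x) simp
  show "decay (real_vec n) \<le> 2 ^ CARD('d) * decay x"
    unfolding e unfolding decay_def using x by (intro prod_mono conjI d) (auto simp: abs_minus_commute)
qed

text \<open>
  Each term is at most a constant times the integral of \<open>decay\<close> over the cell of \<open>n\<close>, and the cells are disjoint,
  so the partial sums stay below a multiple of the full integral.
\<close>

lemma summable_decay: "(\<lambda>n :: int ^ 'd::finite. decay (real_vec n)) summable_on UNIV"
proof (rule nonneg_bdd_above_summable_on)
  show "0 \<le> decay (real_vec n)" for n :: "int ^ 'd" using decay_pos less_imp_le by blast
  have dnn: "0 \<le> decay x" for x :: "real ^ 'd" using decay_pos less_imp_le by blast
  have vol: "has_bochner_integral lborel (indicator (vcell n) :: real ^ 'd \<Rightarrow> real) 1" for n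
    \<comment> \<open>the Fejer kernel of order one is constantly one\<close>
    using has_bochner_integral_fejer_vec_vcell[of 1 n] by (simp add: fejer_vec_def fejer_def)
  have "(\<Sum>n\<in>F. decay (real_vec n)) \<le> 2 ^ CARD('d) * (LINT x|lborel. decay (x :: real ^ 'd))"
    if F: "finite F" for F :: "(int ^ 'd) set"
  proof -
    have int: "integrable lborel (\<lambda>x. indicator (vcell n) x * decay x)" for n :: "int ^ 'd"
      using integrable_decay by (rule Bochner_Integration.integrable_bound) (auto simp: indicator_def)
    have "decay (real_vec n) \<le> 2 ^ CARD('d) * (LINT x|lborel. indicator (vcell n) x * decay x)" for n :: "int ^ 'd"
    proof -
      have "decay (real_vec n) = (LINT x|lborel. indicator (vcell n) x * decay (real_vec n))"
        using has_bochner_integral_integral_eq[OF vol[of n]] by (simp only: integral_mult_left_zero mult_1_left)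
      also have "\<dots> \<le> (LINT x|lborel. 2 ^ CARD('d) * (indicator (vcell n) x * decay x))"
      proof (rule integral_mono)
        show "integrable lborel (\<lambda>x :: real ^ 'd. indicator (vcell n) x * decay (real_vec n))"
          using vol[of n] by (intro integrable_mult_left) (rule has_bochner_integral_iff[THEN iffD1, THEN conjunct1])
        show "integrable lborel (\<lambda>x. 2 ^ CARD('d) * (indicator (vcell n) x * decay x))"
          using int by (intro integrable_mult_right)
      qed (auto simp: indicator_def decay_vcell)
      finally show ?thesis by simp
    qed
    then have "(\<Sum>n\<in>F. decay (real_vec n)) \<le> (\<Sum>n\<in>F. 2 ^ CARD('d) * (LINT x|lborel. indicator (vcell n) x * decay x))"
      by (rule sum_mono)
    also have "\<dots> = 2 ^ CARD('d) * (LINT x|lborel. (\<Sum>n\<in>F. indicator (vcell n) x * decay x))"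
      using int by (simp add: sum_distrib_left)
    also have "(LINT x|lborel. (\<Sum>n\<in>F. indicator (vcell n) x * decay x)) \<le> (LINT x|lborel. decay (x :: real ^ 'd))"
    proof (rule integral_mono)
      show "(\<Sum>n\<in>F. indicator (vcell n) x * decay x) \<le> decay x" for x :: "real ^ 'd"
      proof -
        have "(\<Sum>n\<in>F. indicator (vcell n) x) = (indicator (\<Union>n\<in>F. vcell n) x :: real)"
          using F by (intro indicator_UN_disjoint[symmetric]) (auto simp: disjoint_family_on_def vcell_disjoint)
        then show ?thesis
          using dnn[of x] by (simp add: sum_distrib_right[symmetric] indicator_def)
      qed
    qed (use int integrable_decay in auto)
    finally show ?thesis by simp
  qed
  then show "bdd_above (sum (\<lambda>n :: int ^ 'd. decay (real_vec n)) ` {F. F \<subseteq> UNIV \<and> finite F})"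
    by (intro bdd_aboveI2) auto
qed

lemma summable_on_lattice:
  fixes g :: "real ^ 'd::finite \<Rightarrow> 'a::banach"
  assumes "\<And>x. norm (g x) \<le> C * decay x"
  shows "(\<lambda>n. g (real_vec n)) summable_on UNIV"
  by (rule abs_summable_summable, rule Infinite_Sum.abs_summable_on_comparison_test'[of "\<lambda>n. C * decay (real_vec n)"])
    (auto intro!: summable_on_cmult_right summable_decay assms)

section \<open>Poisson inequality for positive Fourier transforms\<close>

lemma integral_split_vcells:
  fixes h :: "real ^ 'd::finite \<Rightarrow> complex"
  assumes "integrable lborel h" and e: "bij_betw e (UNIV :: nat set) (UNIV :: (int ^ 'd) set)"
  shows "(LINT x|lborel. h x) = (\<Sum>k. LINT x|lborel. indicator (vcell (e k)) x *\<^sub>R h x)"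
proof -
  have U: "(\<Union>k. vcell (e k)) = UNIV"
  proof -
    have "x \<in> (\<Union>k. vcell (e k))" for x
    proof -
      obtain n where "x \<in> vcell n" using ex_vcell by blast
      moreover obtain k where "n = e k" using e by (metis UNIV_I bij_betw_imp_surj_on imageE)
      ultimately show ?thesis by blast
    qed
    then show ?thesis by blast
  qed
  have "inj e" using e by (rule bij_betw_imp_inj_on)
  then have "(LINT x:(\<Union>k. vcell (e k))|lborel. h x) = (\<Sum>k. LINT x:(vcell (e k))|lborel. h x)"
    using assms(1) by (intro lebesgue_integral_countable_add vcell_disjoint)
      (auto simp: U set_integrable_def inj_eq)
  then show ?thesis unfolding U by (simp add: set_lebesgue_integral_def)
qed

text \<open>
  One half of Poisson summation: the right-hand side is formally the sum of the Fourier transform over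
  \<open>t + \<int>\<^sup>d\<close>, of which the left-hand side is the term at \<open>t\<close>. Integrating \<open>f x * exp (- 2 \<pi> \<i> \<langle>x, t\<rangle>)\<close> against
  the Fejer kernel gives values that dominate the Fourier transform at \<open>t\<close> for every order. Cut into cells, each
  piece of that integral converges to the value at its lattice point, and \<open>decay\<close> dominates the
  pieces uniformly, so Tannery's theorem identifies the limit as the sum over the lattice.
\<close>

theorem fourier_le_poisson_sum:
  fixes f :: "real ^ 'd::finite \<Rightarrow> real"
  assumes cont: "continuous_on UNIV f" and bound: "\<And>x. \<bar>f x\<bar> \<le> C * decay x"
    and pos: "\<And>y. fourier f y \<ge> 0"
  shows "fourier f t \<le> (\<Sum>\<^sub>\<infinity>n. complex_of_real (f (real_vec n)) * cis (- 2 * pi * (real_vec n \<bullet> t)))"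
proof -
  define g where "g = (\<lambda>x. complex_of_real (f x) * cis (- 2 * pi * (x \<bullet> t)))"
  have norm_g: "norm (g x) \<le> C * decay x" for x using bound by (simp add: g_def norm_mult)
  have "0 \<le> C * decay (0 :: real ^ 'd)" using norm_g[of 0] norm_ge_zero order_trans by blast
  then have C: "C \<ge> 0" using decay_pos[of "0 :: real ^ 'd"] by (simp add: zero_le_mult_iff)
  have norm_gC: "norm (g x) \<le> C" for x
    using norm_g[of x] mult_left_le[OF decay_le_1 C, of x] by linarith
  have contg: "continuous_on UNIV g" unfolding g_def cis_conv_exp by (intro continuous_intros cont)
  have [measurable]: "f \<in> borel_measurable borel" "g \<in> borel_measurable borel"
    using cont contg by (auto intro: borel_measurable_continuous_onI)
  have Cd: "integrable lborel (\<lambda>x :: real ^ 'd. C * decay x)" by (simp add: integrable_decay)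
  have intf: "integrable lborel f"
    by (rule Bochner_Integration.integrable_bound[OF Cd]) (use bound in \<open>auto intro: order_trans[OF _ abs_ge_self]\<close>)
  have intg: "integrable lborel g"
    by (rule Bochner_Integration.integrable_bound[OF Cd]) (use norm_g in \<open>auto intro: order_trans[OF _ abs_ge_self]\<close>)
  have intgN: "integrable lborel (\<lambda>x. fejer_vec N x *\<^sub>R g x)" for N
  proof -
    have eq: "(\<lambda>x. fejer_vec N x *\<^sub>R g x) = (\<lambda>x. (\<Sum>p\<in>PiE UNIV (\<lambda>_::'d. {..<N} \<times> {..<N}).
        cis (2 * pi * (x \<bullet> (\<chi> i. real (fst (p i)) - real (snd (p i))))) * g x) / of_nat N ^ CARD('d))"
      by (simp add: scaleR_conv_of_real fejer_vec_trig_poly sum_distrib_right)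
    show ?thesis
      unfolding eq
      by (intro Bochner_Integration.integrable_divide_zero Bochner_Integration.integrable_sum
          Bochner_Integration.integrable_bound[OF intg])
        (auto simp: norm_mult cis_conv_exp)
  qed
  define e where "e = from_nat_into (UNIV :: (int ^ 'd) set)"
  have e: "bij_betw e UNIV UNIV"
    unfolding e_def by (rule bij_betw_from_nat_into) (auto simp: infinite_UNIV_vec)
  define M where "M = (\<lambda>k. C * 2 ^ CARD('d) * decay (real_vec (e k)))"
  have sumM: "summable M"
    unfolding M_def
    by (intro summable_mult summable_on_imp_summable)
      (use summable_decay e in \<open>simp add: summable_on_reindex_bij_betw[OF e, of "\<lambda>n. decay (real_vec n)"]\<close>)
  \<comment> \<open>the order is shifted by one since the kernel of order zero vanishes\<close>
  define a where "a = (\<lambda>k N. LINT x|lborel. (indicator (vcell (e k)) x * fejer_vec (Suc N) x) *\<^sub>R g x)"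
  have lim: "(\<lambda>N. a k N) \<longlonglongrightarrow> g (real_vec (e k))" for k
    unfolding a_def by (rule LIMSEQ_Suc[OF fejer_vec_vcell_tendsto[OF contg norm_gC]])
  have bnd: "norm (a k N) \<le> M k" for k N
  proof -
    let ?W = "\<lambda>x. indicator (vcell (e k)) x * fejer_vec (Suc N) x :: real"
    have W: "has_bochner_integral lborel ?W 1" by (rule has_bochner_integral_fejer_vec_vcell) simp
    have "norm (a k N) \<le> (LINT x|lborel. norm (?W x *\<^sub>R g x))"
      unfolding a_def by (rule integral_norm_bound)
    also have "\<dots> \<le> (LINT x|lborel. ?W x * M k)"
    proof (rule integral_mono')
      show "integrable lborel (\<lambda>x. ?W x * M k)" using W by (auto simp: has_bochner_integral_iff)
      show "norm (?W x *\<^sub>R g x) \<le> ?W x * M k" for x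
      proof (cases "x \<in> vcell (e k)")
        case True
        have "norm (g x) \<le> C * decay x" by (rule norm_g)
        also have "\<dots> \<le> M k"
          using mult_left_mono[OF decay_vcell(1)[OF True] C] by (simp add: M_def mult_ac)
        finally show ?thesis by (simp add: True fejer_vec_nonneg mult_left_mono)
      qed simp
      then show "0 \<le> ?W x * M k" for x by (meson norm_ge_zero order_trans)
    qed
    also have "\<dots> = M k" using W by (simp add: has_bochner_integral_iff)
    finally show ?thesis .
  qed
  have "(\<lambda>N. \<Sum>k. a k N) \<longlonglongrightarrow> (\<Sum>k. g (real_vec (e k)))"
  proof -
    have "\<forall>\<^sub>F (k, N) in sequentially \<times>\<^sub>F sequentially. norm (a k N) \<le> M k"
      by (intro always_eventually) (simp add: bnd case_prod_beta)
    from tannerys_theorem[OF lim this sumM] show ?thesis by simp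
  qed
  moreover have "(\<Sum>k. a k N) = (LINT x|lborel. fejer_vec (Suc N) x *\<^sub>R g x)" for N
    using integral_split_vcells[OF intgN e] by (simp add: a_def)
  moreover have "(\<Sum>k. g (real_vec (e k))) = (\<Sum>\<^sub>\<infinity>n. g (real_vec n))"
  proof -
    have "((\<lambda>n. g (real_vec n)) has_sum (\<Sum>\<^sub>\<infinity>n. g (real_vec n))) UNIV"
      by (rule has_sum_infsum[OF summable_on_lattice[OF norm_g]])
    then have "((\<lambda>k. g (real_vec (e k))) has_sum (\<Sum>\<^sub>\<infinity>n. g (real_vec n))) UNIV"
      by (simp add: has_sum_reindex_bij_betw[OF e, of "\<lambda>n. g (real_vec n)"])
    then show ?thesis by (metis has_sum_imp_sums sums_unique)
  qed
  ultimately have L: "(\<lambda>N. LINT x|lborel. fejer_vec (Suc N) x *\<^sub>R g x) \<longlonglongrightarrow> (\<Sum>\<^sub>\<infinity>n. g (real_vec n))" by simp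
  have le: "fourier f t \<le> (LINT x|lborel. fejer_vec (Suc N) x *\<^sub>R g x)" for N
    using fourier_le_fejer_integral[OF intf pos, of "Suc N" t] by (simp add: g_def scaleR_conv_of_real mult_ac)
  have "Re (fourier f t) \<le> Re (\<Sum>\<^sub>\<infinity>n. g (real_vec n))"
    using tendsto_Re[OF L] le by (intro LIMSEQ_le_const) (auto simp: less_eq_complex_def)
  moreover have "(\<lambda>N. Im (fourier f t)) \<longlonglongrightarrow> Im (\<Sum>\<^sub>\<infinity>n. g (real_vec n))"
    using tendsto_Im[OF L] le by (simp add: less_eq_complex_def)
  ultimately show ?thesis
    by (simp add: less_eq_complex_def g_def LIMSEQ_const_iff)
qed

section \<open>Periodization modulo m\<close>

text \<open>
  Each of the \<open>d\<close> factors \<open>1 + x\<^sub>i\<^sup>2\<close> is at most \<open>(1 + |x|)\<^sup>2\<close>, so the rate of order \<open>2 * d\<close> suffices.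
\<close>

lemma rapidly_decreasing_decay:
  fixes f :: "real ^ 'd::finite \<Rightarrow> real"
  assumes "rapidly_decreasing f"
  obtains C where "\<And>x. \<bar>f x\<bar> \<le> C * decay x"
proof -
  have "2 * CARD('d) \<ge> 1" using zero_less_card_finite[where 'a='d] by linarith
  then obtain C where C: "\<And>x. \<bar>f x\<bar> \<le> C / (1 + norm x) ^ (2 * CARD('d))"
    using assms unfolding rapidly_decreasing_def by blast
  have "\<bar>f 0\<bar> \<le> C" using C[of 0] by simp
  then have C0: "C \<ge> 0" by linarith
  have "\<bar>f x\<bar> \<le> C * decay x" for x
  proof -
    have "1 / (1 + norm x) ^ (2 * CARD('d)) = (\<Prod>i\<in>(UNIV :: 'd set). 1 / (1 + norm x)\<^sup>2)"
      by (simp add: power_mult power_one_over)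
    also have "\<dots> \<le> decay x"
      unfolding decay_def
    proof (intro prod_mono conjI divide_left_mono)
      fix i
      have "\<bar>x $ i\<bar>\<^sup>2 \<le> (norm x)\<^sup>2" by (intro power_mono component_le_norm_cart) auto
      then show "1 + (x $ i)\<^sup>2 \<le> (1 + norm x)\<^sup>2" 
        by (simp add: power2_sum) (use norm_ge_zero[of x] in linarith)
    qed (auto intro!: mult_pos_pos zero_less_power add_pos_nonneg)
    finally show ?thesis
      using C[of x] mult_left_mono[OF _ C0] by fastforce
  qed
  then show ?thesis by (rule that)
qed

definition shift :: "nat \<Rightarrow> int ^ 'd::finite \<Rightarrow> int ^ 'd \<Rightarrow> int ^ 'd" where
  "shift m x n = (\<chi> i. x $ i + int m * n $ i)"

definition periodization :: "nat \<Rightarrow> (real ^ 'd::finite \<Rightarrow> real) \<Rightarrow> int ^ 'd \<Rightarrow> real" where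
  "periodization m f x = (\<Sum>\<^sub>\<infinity>n. f (real_vec (shift m x n)))"

lemma inj_shift: "m > 0 \<Longrightarrow> inj (shift m x)"
  by (auto simp: inj_def shift_def vec_eq_iff)

lemma summable_on_shift:
  fixes g :: "real ^ 'd::finite \<Rightarrow> 'a::banach"
  assumes "\<And>x. norm (g x) \<le> C * decay x" and "m > 0"
  shows "(\<lambda>n. g (real_vec (shift m x n))) summable_on UNIV"
proof -
  have "(\<lambda>z. g (real_vec z)) summable_on range (shift m x)"
    by (rule summable_on_subset_banach[OF summable_on_lattice[OF assms(1)]]) auto
  then show ?thesis
    using summable_on_reindex[OF inj_shift[OF assms(2)], of "\<lambda>z. g (real_vec z)" x] by (simp add: o_def)
qed

lemma coset_reps_iff:
  "x \<in> coset_reps m \<longleftrightarrow> (\<forall>i. - int m < 2 * x $ i \<and> 2 * x $ i \<le> int m)"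
proof -
  have "- real m / 2 < real_of_int a \<longleftrightarrow> - int m < 2 * a" "real_of_int a \<le> real m / 2 \<longleftrightarrow> 2 * a \<le> int m" for a
    by linarith+
  then show ?thesis unfolding coset_reps_def by simp
qed

lemma finite_coset_reps: "finite (coset_reps m :: (int ^ 'd::finite) set)"
proof (rule finite_subset)
  show "coset_reps m \<subseteq> vec_lambda ` PiE (UNIV :: 'd set) (\<lambda>_. {- int m..int m})"
  proof
    fix x :: "int ^ 'd" assume "x \<in> coset_reps m"
    then have "x $ i \<in> {- int m..int m}" for i
      unfolding coset_reps_iff by (auto dest!: spec[of _ i])
    then show "x \<in> vec_lambda ` PiE (UNIV :: 'd set) (\<lambda>_. {- int m..int m})"
      by (intro image_eqI[of _ _ "vec_nth x"]) auto
  qed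
qed (intro finite_imageI finite_PiE, auto)

text \<open>
  Division with remainder in every coordinate, the remainder being taken in \<open>(- m / 2, m / 2]\<close>.
\<close>

lemma bij_betw_shift_coset_reps:
  assumes "m > 0"
  shows "bij_betw (\<lambda>(x, n). shift m x n) (coset_reps m \<times> UNIV) (UNIV :: (int ^ 'd::finite) set)"
proof (rule bij_betwI')
  fix p q :: "(int ^ 'd) \<times> (int ^ 'd)"
  assume p: "p \<in> coset_reps m \<times> UNIV" and q: "q \<in> coset_reps m \<times> UNIV"
  show "(case p of (x, n) \<Rightarrow> shift m x n) = (case q of (x, n) \<Rightarrow> shift m x n) \<longleftrightarrow> p = q"
  proof
    assume eq: "(case p of (x, n) \<Rightarrow> shift m x n) = (case q of (x, n) \<Rightarrow> shift m x n)"
    have "snd p $ i = snd q $ i \<and> fst p $ i = fst q $ i" for i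
    proof -
      have e: "fst p $ i + int m * snd p $ i = fst q $ i + int m * snd q $ i"
        using eq by (auto simp: shift_def vec_eq_iff case_prod_beta)
      have "- int m < 2 * fst p $ i" "2 * fst p $ i \<le> int m" "- int m < 2 * fst q $ i" "2 * fst q $ i \<le> int m"
        using p q by (auto simp: coset_reps_iff mem_Times_iff)
      then have lt: "\<bar>fst p $ i - fst q $ i\<bar> < int m" by linarith
      have "fst p $ i - fst q $ i = int m * (snd q $ i - snd p $ i)"
        using e by (simp add: algebra_simps)
      then have "fst p $ i - fst q $ i = 0"
        using lt by (metis dvd_imp_le_int dvd_triv_left abs_of_nat linorder_not_less)
      then show ?thesis using e assms by simp
    qed
    then show "p = q" by (simp add: prod_eq_iff vec_eq_iff)
  qed simp
next
  fix z :: "int ^ 'd"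
  \<comment> \<open>rounding half-integers down puts the remainder into the interval closed on the right\<close>
  define n where "n = (\<chi> i. \<lceil>z $ i / real m - 1 / 2\<rceil>)"
  define x where "x = (\<chi> i. z $ i - int m * n $ i)"
  have "x \<in> coset_reps m"
    unfolding coset_reps_def mem_Collect_eq
  proof
    fix i
    have "real_of_int (n $ i) - 1 < z $ i / real m - 1 / 2" "z $ i / real m - 1 / 2 \<le> n $ i"
      unfolding n_def vec_lambda_beta by linarith+
    then have "real m * (real_of_int (n $ i) - 1) < real m * (z $ i / real m - 1 / 2)"
      "real m * (z $ i / real m - 1 / 2) \<le> real m * n $ i"
      using assms by (auto intro!: mult_left_mono mult_strict_left_mono)
    then show "- real m / 2 < real_of_int (x $ i) \<and> real_of_int (x $ i) \<le> real m / 2"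
      using assms by (simp add: x_def algebra_simps)
  qed
  moreover have "z = shift m x n" by (simp add: shift_def x_def vec_eq_iff)
  ultimately show "\<exists>p\<in>coset_reps m \<times> UNIV. z = (case p of (x, n) \<Rightarrow> shift m x n)"
    by (intro bexI[of _ "(x, n)"]) auto
qed auto

text \<open>
  The character \<open>exp (- 2 \<pi> \<i> \<langle>x, y\<rangle> / m)\<close> is constant on cosets of \<open>m \<int>\<^sup>d\<close>, so summing first within the cosets
  and then over the representatives is one absolutely convergent sum over \<open>\<int>\<^sup>d\<close>.
\<close>

lemma discrete_fourier_periodization:
  fixes f :: "real ^ 'd::finite \<Rightarrow> real"
  assumes bound: "\<And>x. \<bar>f x\<bar> \<le> C * decay x" and "m > 0"
  shows "discrete_fourier m (periodization m f) y =
    complex_of_real (real m powr (- real CARD('d) / 2)) *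
    (\<Sum>\<^sub>\<infinity>z. complex_of_real (f (real_vec z)) * cis (- 2 * pi * (real_vec z \<bullet> ((1 / real m) *\<^sub>R real_vec y))))"
proof -
  define t where "t = (1 / real m) *\<^sub>R real_vec y"
  define g where "g = (\<lambda>x. complex_of_real (f x) * cis (- 2 * pi * (x \<bullet> t)))"
  have norm_g: "norm (g x) \<le> C * decay x" for x using bound by (simp add: g_def norm_mult)
  have char: "exp (- (2 * pi * \<i> / of_nat m) * of_int (\<Sum>i\<in>UNIV. x $ i * y $ i)) = cis (- 2 * pi * (real_vec x \<bullet> t))" for x
    unfolding cis_conv_exp
    by (rule arg_cong[where f=exp]) (simp add: t_def real_vec_def inner_vec_def sum_divide_distrib sum_distrib_left mult_ac)
  have cis_shift: "cis (- 2 * pi * (real_vec (shift m x n) \<bullet> t)) = cis (- 2 * pi * (real_vec x \<bullet> t))" for x n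
  proof -
    have "real_vec (shift m x n) \<bullet> t =
        (\<Sum>i\<in>UNIV. real_of_int (x $ i) * y $ i / m + real_of_int (n $ i * y $ i))"
      unfolding inner_vec_def
      by (rule sum.cong) (use \<open>m > 0\<close> in \<open>auto simp: t_def real_vec_def shift_def field_simps\<close>)
    also have "\<dots> = real_vec x \<bullet> t + of_int (\<Sum>i\<in>UNIV. n $ i * y $ i)"
      by (simp add: sum.distrib inner_vec_def t_def real_vec_def)
    finally have "real_vec (shift m x n) \<bullet> t = real_vec x \<bullet> t + of_int (\<Sum>i\<in>UNIV. n $ i * y $ i)" .
    then have "- 2 * pi * (real_vec (shift m x n) \<bullet> t)
        = - 2 * pi * (real_vec x \<bullet> t) + 2 * pi * of_int (- (\<Sum>i\<in>UNIV. n $ i * y $ i))"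
      by (simp add: algebra_simps)
    moreover have "cis (2 * pi * of_int k) = 1" for k
      by (rule cis_multiple_2pi) simp
    ultimately show ?thesis by (simp only: cis_mult[symmetric] mult_1_right)
  qed
  have "complex_of_real (periodization m f x) * cis (- 2 * pi * (real_vec x \<bullet> t)) = (\<Sum>\<^sub>\<infinity>n. g (real_vec (shift m x n)))" for x
  proof -
    have "((\<lambda>n. f (real_vec (shift m x n))) has_sum periodization m f x) UNIV"
      unfolding periodization_def using bound \<open>m > 0\<close>
      by (intro has_sum_infsum summable_on_shift[of f C]) auto
    then have "((\<lambda>n. complex_of_real (f (real_vec (shift m x n))) * cis (- 2 * pi * (real_vec x \<bullet> t)))
        has_sum (complex_of_real (periodization m f x) * cis (- 2 * pi * (real_vec x \<bullet> t)))) UNIV"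
      by (intro has_sum_cmult_left has_sum_of_real)
    then show ?thesis unfolding g_def cis_shift by (rule infsumI[symmetric])
  qed
  then have "(\<Sum>x \<in> coset_reps m. complex_of_real (periodization m f x) * cis (- 2 * pi * (real_vec x \<bullet> t)))
      = (\<Sum>\<^sub>\<infinity>x\<in>coset_reps m. \<Sum>\<^sub>\<infinity>n. g (real_vec (shift m x n)))"
    by (simp add: finite_coset_reps)
  also have "\<dots> = (\<Sum>\<^sub>\<infinity>(x, n)\<in>coset_reps m \<times> UNIV. g (real_vec (shift m x n)))"
  proof (rule infsum_Sigma'_banach)
    have "(\<lambda>p. g (real_vec (case p of (x, n) \<Rightarrow> shift m x n))) summable_on (coset_reps m \<times> UNIV)"
      unfolding summable_on_reindex_bij_betw[OF bij_betw_shift_coset_reps[OF \<open>m > 0\<close>], of "\<lambda>z. g (real_vec z)"]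
      using norm_g by (rule summable_on_lattice)
    then show "(\<lambda>(x, n). g (real_vec (shift m x n))) summable_on (coset_reps m \<times> UNIV)"
      by (simp add: case_prod_beta')
  qed
  also have "\<dots> = (\<Sum>\<^sub>\<infinity>z. g (real_vec z))"
    using infsum_reindex_bij_betw[OF bij_betw_shift_coset_reps[OF \<open>m > 0\<close>], of "\<lambda>z. g (real_vec z)"]
    by (simp add: case_prod_beta')
  finally show ?thesis
    unfolding discrete_fourier_def char unfolding g_def t_def by simp
qed

lemma periodic_mod_periodization:
  fixes f :: "real ^ 'd::finite \<Rightarrow> real"
  shows "periodic_mod m (periodization m f)"
  unfolding periodic_mod_def
proof (intro allI impI)
  fix x y :: "int ^ 'd" assume "\<forall>i. [x $ i = y $ i] (mod int m)"
  then have "\<forall>i. \<exists>c. x $ i - y $ i = int m * c"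
    by (simp add: cong_iff_dvd_diff dvd_def)
  then obtain k where k: "\<And>i. x $ i - y $ i = int m * k i" by metis
  have "shift m y (n + (\<chi> i. k i)) = shift m x n" for n
    using k by (simp add: shift_def vec_eq_iff algebra_simps) 
  then show "periodization m f x = periodization m f y"
    unfolding periodization_def
    by (intro infsum_reindex_bij_witness[of _ "\<lambda>n. n - (\<chi> i. k i)" "\<lambda>n. n + (\<chi> i. k i)"]) auto
qed

lemma periodization_even:
  assumes "\<And>x. f (- x) = f x"
  shows "periodization m f (- x) = periodization m f x"
proof -
  have "real_vec (shift m x (- n)) = - real_vec (shift m (- x) n)" for n
    by (simp add: shift_def real_vec_def vec_eq_iff)
  then show ?thesis
    unfolding periodization_def using assms
    by (intro infsum_reindex_bij_witness[of _ uminus uminus]) auto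
qed

section \<open>Comparison of the two linear programs\<close>

text \<open>
  A coordinate of a representative has absolute value at most \<open>m / 2\<close>, and moving it by a nonzero multiple of
  \<open>m\<close> leaves an absolute value of at least \<open>m / 2\<close>.
\<close>

lemma norm_shift_ge:
  assumes "x \<in> coset_reps m"
  shows "norm (real_vec (shift m x n)) \<ge> norm (real_vec x)"
proof (rule norm_le_componentwise_cart)
  fix i
  have x: "\<bar>2 * x $ i\<bar> \<le> int m" using assms by (auto simp: coset_reps_iff abs_le_iff dest!: spec[of _ i])
  have "\<bar>x $ i\<bar> \<le> \<bar>x $ i + int m * n $ i\<bar>"
  proof (cases "n $ i = 0")
    case False
    then have "int m * 1 \<le> int m * \<bar>n $ i\<bar>" by (intro mult_left_mono) auto
    then have "int m \<le> \<bar>int m * n $ i\<bar>" by (simp add: abs_mult)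
    with x show ?thesis by linarith
  qed simp
  then show "norm (real_vec x $ i) \<le> norm (real_vec (shift m x n) $ i)"
    unfolding real_vec_def shift_def vec_lambda_beta real_norm_def
    by (metis of_int_abs of_int_le_iff)
qed

lemma norm_shift_0_ge:
  assumes "n \<noteq> 0"
  shows "norm (real_vec (shift m 0 n)) \<ge> real m"
proof -
  obtain i where "n $ i \<noteq> 0" using assms by (auto simp: vec_eq_iff)
  then have "real m * 1 \<le> real m * \<bar>real_of_int (n $ i)\<bar>" by (intro mult_left_mono) auto
  also have "\<dots> = \<bar>real_vec (shift m 0 n) $ i\<bar>" by (simp add: real_vec_def shift_def abs_mult)
  also have "\<dots> \<le> norm (real_vec (shift m 0 n))" by (rule component_le_norm_cart)
  finally show ?thesis by simp
qed

text \<open>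
  Transform conditions: up to the factor \<open>m powr (- d / 2)\<close> the discrete transform at \<open>y\<close> dominates the Fourier
  transform of \<open>f\<close> at \<open>y / m\<close>. Sign conditions: a coset whose representative has norm at least \<open>r\<close> only
  contains vectors where \<open>f\<close> is nonpositive. At the origin the same argument applies to all terms
  but \<open>f 0\<close>, because the nonzero vectors of \<open>m \<int>\<^sup>d\<close> have length at least \<open>m \<ge> r\<close>.
\<close>

theorem periodization_feasible:
  fixes f :: "real ^ 'd::finite \<Rightarrow> real"
  assumes f: "cohn_elkies_feasible r f" and "r > 0" "m > 0" "real m \<ge> r"
  shows "discrete_cohn_elkies_feasible m r (periodization m f)" "periodization m f 0 \<le> f 0"
proof -
  have radial: "radial f" and smooth: "smooth f" and rd: "rapidly_decreasing f"
    and f1: "fourier f 0 \<ge> 1" and neg: "\<And>x. norm x \<ge> r \<Longrightarrow> f x \<le> 0" and pos: "\<And>y. fourier f y \<ge> 0"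
    using f by (auto simp: cohn_elkies_feasible_def)
  obtain C where C: "\<And>x. \<bar>f x\<bar> \<le> C * decay x" using rapidly_decreasing_decay[OF rd] by blast
  have cont: "continuous_on UNIV f" using smooth unfolding smooth_def by (metis C_k.simps(1))
  define c where "c = complex_of_real (real m powr (- real CARD('d) / 2))"
  have c: "c \<ge> 0" by (simp add: c_def less_eq_complex_def)
  have ge: "c * fourier f ((1 / real m) *\<^sub>R real_vec y) \<le> discrete_fourier m (periodization m f) y" for y
    unfolding discrete_fourier_periodization[OF C \<open>m > 0\<close>] c_def[symmetric]
    by (intro mult_left_mono fourier_le_poisson_sum[OF cont C pos] c)
  have "c * 1 \<le> c * fourier f 0" using f1 c by (rule mult_left_mono)
  also have "\<dots> \<le> discrete_fourier m (periodization m f) 0"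
    using ge[of 0] by (simp add: real_vec_def zero_vec_def[symmetric])
  finally have at0: "c \<le> discrete_fourier m (periodization m f) 0" by simp
  have nonneg: "0 \<le> discrete_fourier m (periodization m f) y" for y
    using mult_nonneg_nonneg[OF c pos] ge order_trans by blast
  have summ: "(\<lambda>n. f (real_vec (shift m x n))) summable_on UNIV" for x
    using summable_on_shift[of f C m x] C \<open>m > 0\<close> by simp
  have "periodization m f x \<le> 0" if "x \<in> coset_reps m" "norm (real_vec x) \<ge> r" for x
  proof -
    have "f (real_vec (shift m x n)) \<le> 0" for n
      by (intro neg order_trans[OF that(2) norm_shift_ge[OF that(1)]])
    then have "periodization m f x \<le> (\<Sum>\<^sub>\<infinity>n :: int ^ 'd. 0)"
      unfolding periodization_def by (intro infsum_mono summ summable_on_0_simp)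
    then show ?thesis by simp
  qed
  moreover have "f (- x) = f x" for x
    using radial norm_minus_cancel unfolding radial_def by blast
  ultimately show "discrete_cohn_elkies_feasible m r (periodization m f)"
    unfolding discrete_cohn_elkies_feasible_def c_def[symmetric]
    using at0 nonneg by (auto simp: periodic_mod_periodization periodization_even)
  show "periodization m f 0 \<le> f 0"
  proof -
    have "periodization m f 0 \<le> (\<Sum>\<^sub>\<infinity>n. if n = (0 :: int ^ 'd) then f 0 else 0)"
      unfolding periodization_def
    proof (rule infsum_mono[OF summ])
      show "(\<lambda>n. if n = (0 :: int ^ 'd) then f 0 else 0) summable_on UNIV"
        by (rule finite_nonzero_values_imp_summable_on) (auto intro: finite_subset[of _ "{0}"])
      show "f (real_vec (shift m 0 n)) \<le> (if n = 0 then f 0 else 0)" for n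
        using neg[OF order_trans[OF \<open>real m \<ge> r\<close> norm_shift_0_ge]]
        by (auto simp: shift_def real_vec_def zero_vec_def[symmetric])
    qed
    also have "\<dots> = (\<Sum>\<^sub>\<infinity>n\<in>{0 :: int ^ 'd}. f 0)"
      by (rule infsum_cong_neutral) auto
    finally show ?thesis by simp
  qed
qed

theorem corollary3p3:
  fixes r :: real and m :: nat
  assumes "r > 0" and "m > 0" and "real m \<ge> 2 * r"
  shows "cohn_elkies_bound TYPE('d::finite) r \<ge> discrete_cohn_elkies_bound TYPE('d) m r"
  unfolding cohn_elkies_bound_def
proof (rule INF_greatest)
  fix f :: "real ^ 'd \<Rightarrow> real" assume "f \<in> {f. cohn_elkies_feasible r f}"
  then have f: "cohn_elkies_feasible r f" by simp
  have "real m \<ge> r" using assms by simp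
  note p = periodization_feasible[OF f assms(1,2) this]
  have "discrete_cohn_elkies_bound TYPE('d) m r \<le> ereal ((r / 2) ^ CARD('d) * periodization m f 0)"
    unfolding discrete_cohn_elkies_bound_def using p(1) by (intro INF_lower) simp
  also have "\<dots> \<le> ereal ((r / 2) ^ CARD('d) * f 0)"
    using p(2) assms(1) by (simp add: mult_left_mono)
  finally show "discrete_cohn_elkies_bound TYPE('d) m r \<le> ereal ((r / 2) ^ CARD('d) * f 0)" .
qed

end
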